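(* Let $B(n)=1+\sum_{d\mid n}|\mathrm{cycles}^{(1)}(d)|\,(d+n-2)$ for $n\ge1$. Then $$\frac{B(n)}{(n-1)!}\xrightarrow[n\to\infty]{}2.$$
   Context: Let $n\ge1$. Let $\sigma\in S_n$ be the cycle $\sigma(i)=i+1$ for $i<n$, $\sigma(n)=1$. For $\pi\in S_n$ let $\mathrm{inc}(\pi)=\{\sigma^k\circ\pi:0\le k\le n-1\}$; these sets are the classes of an equivalence relation $\mathcal{R}_2$ on $S_n$ with $(n-1)!$ classes. The map $f(\mathrm{inc}(\pi))=\mathrm{inc}(\pi\circ\sigma)$ is a well-defined permutation of the set of classes. A 1-cycle is an orbit of $f$ (a class fixed by $f$ is a 1-cycle of length 1), and $\mathrm{cycles}^{(1)}(d)$ denotes the set of 1-cycles consisting of exactly $d$ classes. *)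

theory Defs
  imports Complex_Main "HOL-Combinatorics.Orbits"
begin

text \<open>
  \<open>S\<^sub>n\<close> is the set of functions on \<^typ>\<open>nat\<close> that permute \<open>{1..n}\<close> (identity elsewhere).
  All notions below are meant for \<open>n \<ge> 1\<close>.
\<close>

definition shift :: "nat \<Rightarrow> nat \<Rightarrow> nat" where
  "shift n i = (if 1 \<le> i \<and> i < n then i + 1 else if i = n then 1 else i)"

definition inc :: "nat \<Rightarrow> (nat \<Rightarrow> nat) \<Rightarrow> (nat \<Rightarrow> nat) set" where
  "inc n \<pi> = {(shift n ^^ k) \<circ> \<pi> | k. k < n}"

definition inc_classes :: "nat \<Rightarrow> (nat \<Rightarrow> nat) set set" where
  "inc_classes n = inc n ` {\<pi>. \<pi> permutes {1..n}}"

text \<open>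
  The union below has only one distinct member when \<open>C\<close> is a class; lemma \<open>class_map_inc\<close>
  gives the intended equation.
\<close>

definition class_map :: "nat \<Rightarrow> (nat \<Rightarrow> nat) set \<Rightarrow> (nat \<Rightarrow> nat) set" where
  "class_map n C = (\<Union>\<pi>\<in>C. inc n (\<pi> \<circ> shift n))"

definition one_cycles :: "nat \<Rightarrow> nat \<Rightarrow> (nat \<Rightarrow> nat) set set set" where
  "one_cycles n d = {Z. (\<exists>C\<in>inc_classes n. Z = orbit (class_map n) C) \<and> card Z = d}"

definition B_num :: "nat \<Rightarrow> real" where
  "B_num n = 1 + (\<Sum>d | d dvd n. real (card (one_cycles n d)) * (real d + real n - 2))"

lemma shift_permutes:
  assumes "n \<ge> 1"
  shows "shift n permutes {1..n}"
proof (rule bij_imp_permutes)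
  show "bij_betw (shift n) {1..n} {1..n}"
    by (rule bij_betw_byWitness[where f' = "\<lambda>i. if i = 1 then n else i - 1"])
       (use assms in \<open>auto simp: shift_def\<close>)
qed (use assms in \<open>auto simp: shift_def\<close>)

lemma shift_funpow_permutes:
  assumes "n \<ge> 1"
  shows "(shift n ^^ k) permutes {1..n}"
proof (induction k)
  case 0
  show ?case using permutes_id[of "{1..n}"] by (simp add: id_def)
next
  case (Suc k)
  then show ?case
    using permutes_compose[OF Suc shift_permutes[OF assms]] by (simp only: funpow.simps)
qed

lemma shift_funpow:
  assumes "i \<in> {1..n}"
  shows "(shift n ^^ k) i = (i - 1 + k) mod n + 1"
proof (induction k)
  case 0
  then show ?case using assms by auto
next
  case (Suc k)
  have "(i - 1 + k) mod n < n" using assms by auto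
  then show ?case using Suc by (auto simp: shift_def mod_Suc)
qed

lemma shift_funpow_self: "shift n ^^ n = id"
proof (cases "n = 0")
  case False
  show ?thesis
  proof
    fix i
    show "(shift n ^^ n) i = id i"
    proof (cases "i \<in> {1..n}")
      case True
      then have "i - 1 < n" by auto
      then have "(i - 1 + n) mod n = i - 1" by (simp only: mod_add_self2 mod_less)
      with shift_funpow[OF True, of n] have "(shift n ^^ n) i = i - 1 + 1" by (simp only:)
      then show ?thesis using True by simp
    next
      case outside: False
      have "(shift n ^^ n) permutes {1..n}" using False by (intro shift_funpow_permutes) auto
      then show ?thesis using outside by (auto simp: permutes_not_in)
    qed
  qed
qed auto

lemma shift_funpow_mod: "shift n ^^ (k mod n) = shift n ^^ k"
proof -
  have "shift n ^^ (m * n + r) = shift n ^^ r" for m r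
    by (induction m) (auto simp: funpow_add shift_funpow_self add.assoc)
  from this[of "k div n" "k mod n"] show ?thesis by simp
qed

lemma inc_altdef:
  assumes "n \<ge> 1"
  shows "inc n \<pi> = range (\<lambda>k. (shift n ^^ k) \<circ> \<pi>)"
proof
  show "range (\<lambda>k. (shift n ^^ k) \<circ> \<pi>) \<subseteq> inc n \<pi>"
  proof safe
    fix k
    have "(shift n ^^ k) \<circ> \<pi> = (shift n ^^ (k mod n)) \<circ> \<pi>" by (simp add: shift_funpow_mod)
    moreover have "k mod n < n" using assms by simp
    ultimately show "(shift n ^^ k) \<circ> \<pi> \<in> inc n \<pi>" unfolding inc_def by blast
  qed
qed (auto simp: inc_def)

lemma inc_self: "n \<ge> 1 \<Longrightarrow> \<pi> \<in> inc n \<pi>"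
  unfolding inc_def by (auto intro: exI[of _ 0])

lemma inc_eqI:
  assumes "n \<ge> 1" "\<rho> \<in> inc n \<pi>"
  shows "inc n \<rho> = inc n \<pi>"
proof -
  obtain k where k: "k < n" "\<rho> = (shift n ^^ k) \<circ> \<pi>"
    using assms(2) by (auto simp: inc_def)
  have "(shift n ^^ (n - k)) \<circ> \<rho> = (shift n ^^ (n - k + k)) \<circ> \<pi>"
    unfolding k(2) funpow_add by (simp add: comp_assoc)
  then have pi: "\<pi> = (shift n ^^ (n - k)) \<circ> \<rho>"
    using k(1) by (simp add: shift_funpow_self)
  have *: "inc n ((shift n ^^ m) \<circ> \<tau>) \<subseteq> inc n \<tau>" for m \<tau>
  proof -
    have "(shift n ^^ j) \<circ> ((shift n ^^ m) \<circ> \<tau>) = (shift n ^^ (j + m)) \<circ> \<tau>" for j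
      by (simp only: funpow_add comp_assoc)
    then show ?thesis unfolding inc_altdef[OF assms(1)] by blast
  qed
  have "inc n \<rho> \<subseteq> inc n \<pi>" using *[of k \<pi>] by (simp only: k(2))
  moreover have "inc n \<pi> \<subseteq> inc n \<rho>" using *[of "n - k" \<rho>] by (simp only: pi[symmetric])
  ultimately show ?thesis by (rule antisym)
qed

lemma equiv_inc:
  assumes "n \<ge> 1"
  shows "equiv {\<pi>. \<pi> permutes {1..n}}
           {(\<pi>, \<rho>). \<pi> permutes {1..n} \<and> \<rho> permutes {1..n} \<and> inc n \<pi> = inc n \<rho>}"
  by (auto simp: equiv_def refl_on_def sym_def trans_def)

lemma inc_classes_quotient:
  assumes "n \<ge> 1"
  shows "inc_classes n = {\<pi>. \<pi> permutes {1..n}} //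
           {(\<pi>, \<rho>). \<pi> permutes {1..n} \<and> \<rho> permutes {1..n} \<and> inc n \<pi> = inc n \<rho>}"
proof -
  have "inc n \<pi> = {(\<pi>, \<rho>). \<pi> permutes {1..n} \<and> \<rho> permutes {1..n} \<and> inc n \<pi> = inc n \<rho>} `` {\<pi>}"
    if "\<pi> permutes {1..n}" for \<pi>
  proof -
    have "\<rho> permutes {1..n}" if "\<rho> \<in> inc n \<pi>" for \<rho>
      using that \<open>\<pi> permutes {1..n}\<close> shift_funpow_permutes[OF assms]
      by (auto simp: inc_def intro!: permutes_compose)
    then show ?thesis using that inc_eqI[OF assms] inc_self[OF assms] by blast
  qed
  then show ?thesis unfolding inc_classes_def quotient_def by auto
qed

lemma class_map_inc: "class_map n (inc n \<pi>) = inc n (\<pi> \<circ> shift n)"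
proof (cases "n = 0")
  case False
  then have n: "n \<ge> 1" by simp
  have "inc n (\<rho> \<circ> shift n) = inc n (\<pi> \<circ> shift n)" if "\<rho> \<in> inc n \<pi>" for \<rho>
    using that by (intro inc_eqI[OF n]) (auto simp: inc_def comp_assoc)
  then show ?thesis using inc_self[OF n, of \<pi>] unfolding class_map_def by blast
qed (auto simp: class_map_def inc_def)

lemma class_map_bij:
  assumes "n \<ge> 1"
  shows "bij_betw (class_map n) (inc_classes n) (inc_classes n)"
proof -
  have sub: "class_map n ` inc_classes n \<subseteq> inc_classes n"
    using shift_permutes[OF assms]
    by (auto simp: inc_classes_def class_map_inc intro!: imageI permutes_compose)
  have fin: "finite (inc_classes n)"
    unfolding inc_classes_def by (intro finite_imageI finite_permutations) auto
  have "inc_classes n \<subseteq> class_map n ` inc_classes n"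
  proof
    fix C assume "C \<in> inc_classes n"
    then obtain \<pi> where pi: "\<pi> permutes {1..n}" "C = inc n \<pi>" by (auto simp: inc_classes_def)
    define \<rho> where "\<rho> = \<pi> \<circ> inv (shift n)"
    have "\<rho> permutes {1..n}"
      unfolding \<rho>_def by (intro permutes_compose permutes_inv shift_permutes assms pi)
    moreover have "\<rho> \<circ> shift n = \<pi>"
      unfolding \<rho>_def comp_assoc using permutes_inv_o(2)[OF shift_permutes[OF assms]] by simp
    ultimately show "C \<in> class_map n ` inc_classes n"
      unfolding pi(2) inc_classes_def using class_map_inc[of n \<rho>] by auto
  qed
  with sub have eq: "class_map n ` inc_classes n = inc_classes n" by blast
  then show ?thesis
    using eq_card_imp_inj_on[OF fin, of "class_map n"] by (simp add: bij_betw_def)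
qed

end

theory Submission
  imports Defs "HOL-Library.FuncSet" "HOL-Real_Asymp.Real_Asymp"
begin

text \<open>
  The sizes of the orbits add up to \<open>(n - 1)!\<close>, so \<open>B(n) = 1 + (n - 1)! + (n - 2) M\<close> with \<open>M\<close> the
  number of orbits. Orbit sizes divide \<open>n\<close>, hence \<open>M \<ge> (n - 1)! / n\<close>. Conversely a class in an orbit
  of size \<open>d < n\<close> is represented by some \<open>\<pi>\<close> with \<open>\<pi> \<circ> \<sigma>\<^sup>d = \<sigma>\<^sup>j \<circ> \<pi>\<close>; as \<open>d \<le> n / 2\<close>, such a \<open>\<pi>\<close> is
  determined by \<open>d\<close>, \<open>j\<close> and its values on the first half of \<open>{1..n}\<close>. So there are at most
  \<open>n\<^bsup>n/2 + 2\<^esup>\<close> short orbits, which is negligible against \<open>(n - 1)!\<close>.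
\<close>

section \<open>Orbits of a map with a power fixing a set\<close>

text \<open>\<open>orbit f x\<close> collects only the iterates with positive exponent, so
  \<open>x\<close> itself belongs to it only through a return to \<open>x\<close>.\<close>

lemma self_in_orbit_funpow:
  assumes "(f ^^ n) x = x" "0 < n"
  shows "x \<in> orbit f x"
  using assms unfolding orbit_altdef by force

text \<open>The iterates up to the first return to \<open>x\<close> are pairwise distinct and
  exhaust the orbit.\<close>

lemma card_orbit_eq_funpow_dist1:
  assumes "x \<in> orbit f x"
  shows "card (orbit f x) = funpow_dist1 f x x"
  unfolding orbit_conv_funpow_dist1[OF assms]
  using card_image[OF inj_on_funpow_dist1[OF assms]] by simp

lemma funpow_card_orbit:
  assumes "x \<in> orbit f x"
  shows "(f ^^ card (orbit f x)) x = x"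
  using funpow_dist1_prop[OF assms] by (simp only: card_orbit_eq_funpow_dist1[OF assms])

text \<open>The orbit size is the least positive period of \<open>x\<close>. The remainder of
  \<open>n\<close> modulo it is again a period, but a smaller one, hence zero.\<close>

lemma card_orbit_dvd:
  assumes "(f ^^ n) x = x" "0 < n"
  shows "card (orbit f x) dvd n"
proof -
  let ?d = "card (orbit f x)"
  have x: "x \<in> orbit f x" by (rule self_in_orbit_funpow[OF assms])
  have d: "?d = funpow_dist1 f x x" by (rule card_orbit_eq_funpow_dist1[OF x])
  have "(f ^^ (n mod ?d)) x = x"
    using funpow_mod_eq[OF funpow_card_orbit[OF x], of n] assms(1) by simp
  moreover have "n mod ?d < funpow_dist1 f x x" unfolding d by simp
  ultimately have "n mod ?d = 0"
    using funpow_dist1_least[of "n mod ?d" f x x] by (metis neq0_conv)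
  then show ?thesis by auto
qed

lemma orbit_eq_if_Int:
  assumes "x \<in> orbit f x" "y \<in> orbit f y" "orbit f x \<inter> orbit f y \<noteq> {}"
  shows "orbit f x = orbit f y"
proof -
  obtain z where z: "z \<in> orbit f x" "z \<in> orbit f y" using assms(3) by blast
  have "x \<in> orbit f z" "y \<in> orbit f z" using z assms by (auto intro: orbit_swap)
  then show ?thesis using z by (auto intro: orbit_trans)
qed

section \<open>The classes\<close>

lemma finite_inc_classes: "finite (inc_classes n)"
  unfolding inc_classes_def by (intro finite_imageI finite_permutations) auto

lemma card_inc:
  assumes "n \<ge> 1" "\<pi> permutes {1..n}"
  shows "card (inc n \<pi>) = n"
proof -
  have "inj_on (\<lambda>k. (shift n ^^ k) \<circ> \<pi>) {..<n}"
  proof (rule inj_onI)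
    fix k l
    assume kl: "k \<in> {..<n}" "l \<in> {..<n}" and eq: "(shift n ^^ k) \<circ> \<pi> = (shift n ^^ l) \<circ> \<pi>"
    \<comment> \<open>Powers of the cycle with exponents below \<open>n\<close> are told apart by
      their value at 1, so both sides are evaluated at the preimage of 1.\<close>
    have "(shift n ^^ k) (\<pi> (inv \<pi> 1)) = (shift n ^^ l) (\<pi> (inv \<pi> 1))"
      using fun_cong[OF eq, of "inv \<pi> 1"] by simp
    then have "(shift n ^^ k) 1 = (shift n ^^ l) 1"
      by (simp add: permutes_inverses(1)[OF assms(2)])
    then show "k = l" using assms(1) kl by (simp add: shift_funpow)
  qed
  moreover have "inc n \<pi> = (\<lambda>k. (shift n ^^ k) \<circ> \<pi>) ` {..<n}"
    unfolding inc_def by auto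
  ultimately show ?thesis by (simp add: card_image)
qed

text \<open>The classes partition the \<open>fact n\<close> permutations into blocks of size
  \<open>n\<close>.\<close>

lemma card_inc_classes:
  assumes "n \<ge> 1"
  shows "card (inc_classes n) = fact (n - 1)"
proof -
  let ?S = "{\<pi>. \<pi> permutes {1..n}}"
  have "\<rho> permutes {1..n}" if "\<rho> \<in> inc n \<pi>" "\<pi> permutes {1..n}" for \<rho> \<pi>
    using that shift_funpow_permutes[OF assms] by (auto simp: inc_def intro!: permutes_compose)
  then have Un: "\<Union> (inc_classes n) = ?S"
    unfolding inc_classes_def using inc_self[OF assms] by blast
  have "n * card (inc_classes n) = card (\<Union> (inc_classes n))"
  proof (rule card_partition)
    show "finite (\<Union> (inc_classes n))" unfolding Un by (intro finite_permutations) auto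
    show "card C = n" if "C \<in> inc_classes n" for C
      using that card_inc[OF assms] by (auto simp: inc_classes_def)
    show "C \<inter> D = {}" if "C \<in> inc_classes n" "D \<in> inc_classes n" "C \<noteq> D" for C D
      using that inc_eqI[OF assms] unfolding inc_classes_def by blast
  qed (rule finite_inc_classes)
  also have "\<dots> = fact n" unfolding Un by (rule card_permutations) auto
  also have "\<dots> = n * fact (n - 1)" using assms by (subst fact_reduce) auto
  finally show ?thesis using assms by simp
qed

lemma funpow_class_map_inc: "(class_map n ^^ k) (inc n \<pi>) = inc n (\<pi> \<circ> (shift n ^^ k))"
proof (induction k)
  case (Suc k)
  have "(class_map n ^^ Suc k) (inc n \<pi>) = class_map n (inc n (\<pi> \<circ> (shift n ^^ k)))"
    by (simp only: funpow.simps comp_def Suc)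
  also have "\<dots> = inc n (\<pi> \<circ> (shift n ^^ Suc k))"
    by (simp only: class_map_inc comp_assoc funpow_Suc_right)
  finally show ?case .
qed simp

lemma funpow_class_map_self:
  assumes "C \<in> inc_classes n"
  shows "(class_map n ^^ n) C = C"
  using assms by (auto simp: inc_classes_def funpow_class_map_inc shift_funpow_self)

lemma class_map_in: "n \<ge> 1 \<Longrightarrow> C \<in> inc_classes n \<Longrightarrow> class_map n C \<in> inc_classes n"
  using class_map_bij by (auto dest: bij_betwE)

lemma orbit_class_map_subset:
  assumes "n \<ge> 1" "C \<in> inc_classes n"
  shows "orbit (class_map n) C \<subseteq> inc_classes n"
proof
  fix D assume "D \<in> orbit (class_map n) C"
  then show "D \<in> inc_classes n"
    by induction (use assms class_map_in in auto)
qed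

section \<open>Few classes lie in short orbits\<close>

text \<open>The relation gives \<open>\<pi> i\<close> from \<open>\<pi> (i - d)\<close>. Since the
  first half contains \<open>{1..d}\<close>, the values there propagate to all of
  \<open>{1..n}\<close>, and the count is at most the number of maps from that half to
  \<open>{1..n}\<close>.\<close>

lemma card_commuting_permutations_le:
  assumes "1 \<le> d" "d \<le> n div 2"
  shows "card {\<pi>. \<pi> permutes {1..n} \<and> \<pi> \<circ> (shift n ^^ d) = (shift n ^^ j) \<circ> \<pi>} \<le> n ^ (n div 2)"
    (is "card ?P \<le> _")
proof -
  let ?H = "{1..n div 2}"
  have "inj_on (\<lambda>\<pi>. restrict \<pi> ?H) ?P"
  proof (rule inj_onI)
    fix \<pi> \<rho> assume P: "\<pi> \<in> ?P" "\<rho> \<in> ?P" and eq: "restrict \<pi> ?H = restrict \<rho> ?H"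
    have "\<pi> i = \<rho> i" if "i \<in> {1..n}" for i
      using that
    proof (induction i rule: less_induct)
      case (less i)
      show ?case
      proof (cases "i \<le> n div 2")
        case True
        then show ?thesis using fun_cong[OF eq, of i] less.prems by simp
      next
        case False
        \<comment> \<open>Here \<open>d \<le> n div 2 < i\<close>, so \<open>i - d\<close> is still
          at least 1 and the shift does not wrap around.\<close>
        have i: "(shift n ^^ d) (i - d) = i"
          using False assms less.prems by (subst shift_funpow) auto
        have step: "\<tau> i = (shift n ^^ j) (\<tau> (i - d))" if "\<tau> \<in> ?P" for \<tau>
        proof -
          have "\<tau> \<circ> (shift n ^^ d) = (shift n ^^ j) \<circ> \<tau>" using that by simp
          from fun_cong[OF this, of "i - d"] show ?thesis by (simp add: i)
        qed
        have "\<pi> (i - d) = \<rho> (i - d)" using less False assms by auto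
        then show ?thesis by (simp only: step[OF P(1)] step[OF P(2)])
      qed
    qed
    moreover have "\<pi> i = \<rho> i" if "i \<notin> {1..n}" for i
      using permutes_not_in[of \<pi> "{1..n}" i] permutes_not_in[of \<rho> "{1..n}" i] P that by simp
    ultimately show "\<pi> = \<rho>" by blast
  qed
  moreover have "(\<lambda>\<pi>. restrict \<pi> ?H) ` ?P \<subseteq> ?H \<rightarrow>\<^sub>E {1..n}"
  proof (rule image_subsetI)
    fix \<pi> assume P: "\<pi> \<in> ?P"
    have "\<pi> i \<in> {1..n}" if "i \<in> ?H" for i
      using permutes_in_image[of \<pi> "{1..n}" i] P that by auto
    then show "restrict \<pi> ?H \<in> ?H \<rightarrow>\<^sub>E {1..n}" by auto
  qed
  ultimately have "card ?P \<le> card (?H \<rightarrow>\<^sub>E {1..n})"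
    by (intro card_inj_on_le finite_PiE) auto
  then show ?thesis by (simp add: card_PiE)
qed

lemma card_short_classes_le:
  assumes "n \<ge> 1"
  shows "card {C \<in> inc_classes n. card (orbit (class_map n) C) < n} \<le> n ^ (n div 2 + 2)"
    (is "card ?S \<le> _")
proof -
  define P where
    "P = (\<lambda>(d, j). {\<pi>. \<pi> permutes {1..n} \<and> \<pi> \<circ> (shift n ^^ d) = (shift n ^^ j) \<circ> \<pi>})"
  let ?I = "{1..n div 2} \<times> {..<n}"
  have finP: "finite (P x)" for x
    using finite_permutations[of "{1..n}"] by (auto simp: P_def split: prod.split)
  have "?S \<subseteq> inc n ` (\<Union>x\<in>?I. P x)"
  proof
    fix C assume "C \<in> ?S"
    then obtain \<pi> where \<pi>: "\<pi> permutes {1..n}" "C = inc n \<pi>" and C: "C \<in> inc_classes n"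
      and lt: "card (orbit (class_map n) C) < n"
      by (auto simp: inc_classes_def)
    define d where "d = card (orbit (class_map n) C)"
    have self: "(class_map n ^^ n) C = C" "0 < n" using funpow_class_map_self[OF C] assms by auto
    obtain m where m: "n = d * m" using card_orbit_dvd[OF self] unfolding d_def by (elim dvdE)
    \<comment> \<open>A proper divisor of \<open>n\<close> has cofactor at least 2, hence is at most
      half of \<open>n\<close>.\<close>
    have "m \<noteq> 0" using m assms by (intro notI) simp
    moreover have "m \<noteq> 1" using m lt unfolding d_def[symmetric] by (intro notI) simp
    ultimately have "2 \<le> m" by linarith
    then have "d * 2 \<le> n" using m by simp
    moreover have "d \<ge> 1" using m assms by (cases "d = 0") auto
    ultimately have d: "d \<in> {1..n div 2}" by auto
    have "(class_map n ^^ d) C = C"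
      unfolding d_def by (rule funpow_card_orbit[OF self_in_orbit_funpow[OF self]])
    \<comment> \<open>That the class returns after \<open>d\<close> steps says that right
      multiplication by the \<open>d\<close>-th power stays in the class, where it must agree with
      some left multiplication.\<close>
    then have "\<pi> \<circ> (shift n ^^ d) \<in> inc n \<pi>"
      using inc_self[OF assms, of "\<pi> \<circ> (shift n ^^ d)"] \<pi>(2) funpow_class_map_inc[of d n \<pi>] by simp
    then obtain j where "j < n" "\<pi> \<circ> (shift n ^^ d) = (shift n ^^ j) \<circ> \<pi>"
      by (auto simp: inc_def)
    then have "\<pi> \<in> P (d, j)" "(d, j) \<in> ?I" using d \<pi>(1) by (auto simp: P_def)
    then show "C \<in> inc n ` (\<Union>x\<in>?I. P x)" using \<pi>(2) by blast
  qed
  then have "card ?S \<le> card (inc n ` (\<Union>x\<in>?I. P x))"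
    by (intro card_mono finite_imageI finite_UN_I finP) auto
  also have "\<dots> \<le> card (\<Union>x\<in>?I. P x)"
    by (intro card_image_le finite_UN_I finP) auto
  also have "\<dots> \<le> (\<Sum>x\<in>?I. card (P x))" by (intro card_UN_le) auto
  also have "\<dots> \<le> (\<Sum>x\<in>?I. n ^ (n div 2))"
  proof (rule sum_mono)
    fix x assume "x \<in> ?I"
    then obtain d j where "x = (d, j)" "1 \<le> d" "d \<le> n div 2" by auto
    then show "card (P x) \<le> n ^ (n div 2)"
      using card_commuting_permutations_le[of d n j] by (simp add: P_def)
  qed
  also have "\<dots> = (n div 2) * n * n ^ (n div 2)" by simp
  also have "\<dots> \<le> n * n * n ^ (n div 2)" by (intro mult_right_mono) auto
  also have "\<dots> = n ^ (n div 2 + 2)" by (simp add: power_add power2_eq_square)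
  finally show ?thesis .
qed

section \<open>Counting the orbits\<close>

text \<open>The 1-cycles of all sizes together; \<open>one_cycles n d\<close> is the part of
  cardinality \<open>d\<close>.\<close>

definition orbits :: "nat \<Rightarrow> (nat \<Rightarrow> nat) set set set" where
  "orbits n = orbit (class_map n) ` inc_classes n"

lemma finite_orbits: "finite (orbits n)"
  unfolding orbits_def by (intro finite_imageI finite_inc_classes)

context
  fixes n :: nat
  assumes n: "n \<ge> 1"
begin

lemma self_in_orbit_class_map: "C \<in> inc_classes n \<Longrightarrow> C \<in> orbit (class_map n) C"
  by (rule self_in_orbit_funpow[OF funpow_class_map_self]) (use n in auto)

lemma orbits_disjoint: "Y \<in> orbits n \<Longrightarrow> Z \<in> orbits n \<Longrightarrow> Y \<noteq> Z \<Longrightarrow> Y \<inter> Z = {}"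
  unfolding orbits_def using orbit_eq_if_Int[OF self_in_orbit_class_map self_in_orbit_class_map]
  by (elim imageE) metis

lemma finite_in_orbits: "Z \<in> orbits n \<Longrightarrow> finite Z"
  unfolding orbits_def using finite_orbit[OF self_in_orbit_class_map] by (elim imageE) simp

lemma card_in_orbits_dvd: "Z \<in> orbits n \<Longrightarrow> card Z dvd n"
  unfolding orbits_def using card_orbit_dvd[OF funpow_class_map_self, of _ n] n
  by (elim imageE) simp

lemma sum_card_orbits: "(\<Sum>Z\<in>orbits n. card Z) = fact (n - 1)"
proof -
  have "\<Union> (orbits n) = inc_classes n"
    unfolding orbits_def using orbit_class_map_subset[OF n] self_in_orbit_class_map
    by (intro equalityI Union_least UN_I subsetI) auto
  moreover have "card (\<Union> (orbits n)) = (\<Sum>Z\<in>orbits n. card Z)"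
    by (intro card_Union_disjoint)
      (auto simp: pairwise_def disjnt_def finite_in_orbits dest: orbits_disjoint)
  ultimately show ?thesis using card_inc_classes[OF n] by simp
qed

text \<open>All orbit sizes divide \<open>n\<close>, so the double sum over divisors and 1-cycles
  regroups into one sum over all orbits, in which the sizes add up to the number of classes.\<close>

lemma B_num_eq: "B_num n = 1 + fact (n - 1) + (real n - 2) * real (card (orbits n))"
proof -
  have "one_cycles n d = {Z \<in> orbits n. card Z = d}" for d
    unfolding one_cycles_def orbits_def by auto
  then have "B_num n - 1 =
      (\<Sum>d | d dvd n. \<Sum>Z | Z \<in> orbits n \<and> card Z = d. real (card Z) + real n - 2)"
    unfolding B_num_def by simp
  also have "\<dots> = (\<Sum>Z\<in>orbits n. real (card Z) + real n - 2)"
    using n card_in_orbits_dvd by (intro sum.group finite_orbits) auto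
  also have "\<dots> = (\<Sum>Z\<in>orbits n. real (card Z)) + (real n - 2) * real (card (orbits n))"
    by (simp add: sum.distrib sum_subtractf algebra_simps)
  also have "(\<Sum>Z\<in>orbits n. real (card Z)) = fact (n - 1)"
    using sum_card_orbits by (metis of_nat_fact of_nat_sum)
  finally show ?thesis by simp
qed

lemma card_orbits_ge: "fact (n - 1) \<le> n * card (orbits n)"
proof -
  have "(\<Sum>Z\<in>orbits n. card Z) \<le> (\<Sum>Z\<in>orbits n. n)"
    using n by (intro sum_mono dvd_imp_le card_in_orbits_dvd) auto
  then show ?thesis by (simp add: sum_card_orbits mult.commute)
qed

text \<open>The orbits of full size \<open>n\<close> are disjoint, so \<open>n\<close> times their
  number is at most the number of classes. Short orbits are no more numerous than the classes in
  them; the factor \<open>n\<close> raises the exponent from 2 to 3.\<close>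

lemma card_orbits_le: "n * card (orbits n) \<le> fact (n - 1) + n ^ (n div 2 + 3)"
proof -
  let ?L = "{Z \<in> orbits n. card Z = n}" and ?S = "{Z \<in> orbits n. card Z < n}"
  have "card Z \<le> n" if "Z \<in> orbits n" for Z
    using dvd_imp_le[OF card_in_orbits_dvd[OF that]] n by simp
  then have "orbits n = ?L \<union> ?S" by (auto simp: order_less_le)
  then have "card (orbits n) \<le> card ?L + card ?S" by (metis (lifting) card_Un_le)
  moreover have "n * card ?L \<le> fact (n - 1)"
  proof -
    have "n * card ?L = (\<Sum>Z\<in>?L. card Z)" by simp
    also have "\<dots> \<le> (\<Sum>Z\<in>orbits n. card Z)" by (intro sum_mono2 finite_orbits) auto
    finally show ?thesis by (simp add: sum_card_orbits)
  qed
  moreover have "card ?S \<le> n ^ (n div 2 + 2)"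
  proof -
    let ?C = "{C \<in> inc_classes n. card (orbit (class_map n) C) < n}"
    have "?S \<subseteq> orbit (class_map n) ` ?C" unfolding orbits_def by auto
    then have "card ?S \<le> card ?C"
      using finite_inc_classes by (intro surj_card_le) auto
    also note card_short_classes_le[OF n]
    finally show ?thesis .
  qed
  ultimately have "n * card (orbits n) \<le> fact (n - 1) + n * n ^ (n div 2 + 2)"
    by (smt (verit) add_mono distrib_left mult_le_mono2 order_trans)
  then show ?thesis by (simp add: numeral_3_eq_3 numeral_2_eq_2)
qed

end

section \<open>Asymptotics\<close>

text \<open>The left side is a single term of the exponential series at \<open>n\<close>, whose
  terms are all nonnegative.\<close>

lemma power_div_fact_le_exp: "real n ^ n / fact n \<le> exp (real n)"
proof -
  have "(\<Sum>k\<in>{n}. real n ^ k /\<^sub>R fact k) \<le> (\<Sum>k. real n ^ k /\<^sub>R fact k)"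
    by (intro sum_le_suminf summable_exp_generic) auto
  then show ?thesis by (simp add: exp_def divide_inverse mult.commute)
qed

lemma power_half_div_fact_tendsto_0:
  "(\<lambda>n. real n ^ (n div 2 + m) / fact n) \<longlonglongrightarrow> 0"
proof (rule tendsto_sandwich[of "\<lambda>_. 0"])
  \<comment> \<open>The majorant equals \<open>n\<close> to the power \<open>m - n/2\<close> times
    the exponential of \<open>n\<close>. Real exponents remove the integer division.\<close>
  show "\<forall>\<^sub>F n in sequentially.
      real n ^ (n div 2 + m) / fact n
        \<le> real n powr (real n / 2 + real m) * exp (real n) * real n powr (- real n)"
    using eventually_gt_at_top[of 0]
  proof eventually_elim
    case (elim n)
    have "real n ^ (n div 2 + m) = real n powr (real (n div 2) + real m)"
      using elim by (simp flip: powr_realpow)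
    also have "\<dots> \<le> real n powr (real n / 2 + real m)"
      using elim by (intro powr_mono) auto
    finally have "real n ^ (n div 2 + m) / fact n \<le> real n powr (real n / 2 + real m) * (1 / fact n)"
      by (simp add: divide_right_mono)
    also have "1 / fact n \<le> exp (real n) * real n powr (- real n)"
      using power_div_fact_le_exp[of n] elim
      by (simp add: powr_minus powr_realpow field_simps)
    finally show ?case by (simp add: mult.assoc mult_left_mono)
  qed
  show "(\<lambda>n. real n powr (real n / 2 + real m) * exp (real n) * real n powr (- real n)) \<longlonglongrightarrow> 0"
    by real_asymp
qed auto

theorem theorem8:
  shows "(\<lambda>n. B_num n / fact (n - 1)) \<longlonglongrightarrow> 2"
proof (rule tendsto_sandwich)
  \<comment> \<open>Dividing by \<open>fact (n - 1)\<close>, which is \<open>fact n / n\<close>,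
    lifts the exponent of the short-orbit bound from 3 to 4.\<close>
  let ?e = "\<lambda>n. real n ^ (n div 2 + 4) / fact n"
  have facts: "fact n = real n * fact (n - 1)" if "n \<ge> 2" for n
    using that by (subst fact_reduce) auto
  \<comment> \<open>From \<open>n = 2\<close> on, the factor \<open>n - 2\<close> is nonnegative and
    preserves the lower bound for the number of orbits.\<close>
  show "\<forall>\<^sub>F n in sequentially. 1 + (real n - 2) / real n \<le> B_num n / fact (n - 1)"
    using eventually_ge_at_top[of 2]
  proof eventually_elim
    case (elim n)
    have "(fact (n - 1) :: real) \<le> real n * real (card (orbits n))"
      using card_orbits_ge[of n] elim
      by (metis One_nat_def Suc_leD numeral_2_eq_2 of_nat_fact of_nat_le_iff of_nat_mult)
    then have "1 / real n \<le> real (card (orbits n)) / fact (n - 1)"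
      using elim by (simp add: field_simps)
    then have "(real n - 2) * (1 / real n) \<le> (real n - 2) * (real (card (orbits n)) / fact (n - 1))"
      using elim by (intro mult_left_mono) auto
    moreover have "B_num n / fact (n - 1) =
        1 / fact (n - 1) + 1 + (real n - 2) * (real (card (orbits n)) / fact (n - 1))"
      using elim by (simp add: B_num_eq add_divide_distrib)
    ultimately show ?case by (simp add: add_increasing)
  qed
  show "\<forall>\<^sub>F n in sequentially. B_num n / fact (n - 1) \<le> 2 + real n / fact n + ?e n"
    using eventually_ge_at_top[of 2]
  proof eventually_elim
    case (elim n)
    let ?M = "real (card (orbits n))"
    have "real (n * card (orbits n)) \<le> real (fact (n - 1) + n ^ (n div 2 + 3))"
      using card_orbits_le[of n] elim by (intro of_nat_mono) auto
    \<comment> \<open>Replacing \<open>n - 2\<close> by \<open>n\<close> is harmless: the orbit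
      bound then supplies the second \<open>fact (n - 1)\<close>.\<close>
    moreover have "(real n - 2) * ?M \<le> real n * ?M" by (intro mult_right_mono) auto
    ultimately have "B_num n \<le> 1 + 2 * fact (n - 1) + real n ^ (n div 2 + 3)"
      using elim by (simp add: B_num_eq)
    then have "B_num n / fact (n - 1) \<le> (1 + 2 * fact (n - 1) + real n ^ (n div 2 + 3)) / fact (n - 1)"
      by (intro divide_right_mono) auto
    also have "\<dots> = 2 + real n / fact n + ?e n"
      using elim by (simp add: facts add_divide_distrib power_add eval_nat_numeral)
    finally show ?case .
  qed
  show "(\<lambda>n. 1 + (real n - 2) / real n) \<longlonglongrightarrow> 2" by real_asymp
  have "(\<lambda>n. real n / fact n) \<longlonglongrightarrow> 0"
  \<comment> \<open>The exponent \<open>n div 2 + 1\<close> is at least 1, so the limit with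
    \<open>m = 1\<close> dominates.\<close>
  proof (rule tendsto_sandwich[of "\<lambda>_. 0", OF _ _ _ power_half_div_fact_tendsto_0[of 1]])
    show "\<forall>\<^sub>F n in sequentially. real n / fact n \<le> real n ^ (n div 2 + 1) / fact n"
      using eventually_ge_at_top[of 1]
    proof eventually_elim
      case (elim n)
      then have "real n ^ 1 \<le> real n ^ (n div 2 + 1)" by (intro power_increasing) auto
      then show ?case by (simp add: divide_right_mono)
    qed
  qed auto
  from tendsto_add[OF tendsto_add[OF tendsto_const this] power_half_div_fact_tendsto_0]
  show "(\<lambda>n. 2 + real n / fact n + ?e n) \<longlonglongrightarrow> 2" by simp
qed

end
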